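(* Let $a\geq 1$ be an integer, and let $K(a)$ (respectively $N(a)$) be the largest dimension (respectively the largest length) of a projective $[n,k]_2$ three-weight code $C$ with non-zero weights $w_1<w_2<w_3$ satisfying $w_1+w_2+w_3=\tfrac{3n}{2}$ and $w_2=\tfrac{n}{2}$ such that $C$ is not $2^a$-divisible. Then $$2a+1\leq K(a)\leq 8a+1\qquad\text{and}\qquad 2^{2a+1}-2^{a+1}\leq N(a)\leq 2^{K(a)}-3.$$
   Context: An $[n,k]_2$ code is a $k$-dimensional linear subspace $C$ of $\mathbb{F}_2^n$; $n$ is its length and $k$ its dimension; the weight of a codeword is its number of non-zero entries. The code is full-length if for no coordinate position all codewords vanish at that position. A binary code is projective if it is full-length and no two distinct coordinate positions $i\neq j$ satisfy $c_i=c_j$ for all $c\in C$. A three-weight code is a linear code having exactly three different non-zero weights. A code is $\Delta$-divisible (for an integer $\Delta\geq1$) if all its weights are divisible by $\Delta$. The maxima $K(a)$ and $N(a)$ are each taken over all codes of the described kind, of any length $n$ and dimension $k$ (the two maxima are taken independently); they exist. *)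

theory Defs
  imports
    Complex_Main
    "HOL-Library.Z2"
    "Jordan_Normal_Form.VS_Connect"
begin

text \<open>The field with two elements is the type \<^typ>\<open>bit\<close>, its n-th power is the vector space
  \<open>module_vec TYPE(bit) n\<close> with carrier \<open>carrier_vec n\<close>, and coordinates are numbered from
  \<open>0\<close> to \<open>n - 1\<close>.\<close>

definition binary_code :: "nat \<Rightarrow> nat \<Rightarrow> bit vec set \<Rightarrow> bool" where
  "binary_code n k C \<longleftrightarrow>
     VectorSpace.subspace class_ring C (module_vec TYPE(bit) n) \<and>
     vectorspace.dim class_ring ((module_vec TYPE(bit) n)\<lparr>carrier := C\<rparr>) = k"

definition weight :: "bit vec \<Rightarrow> nat" where
  "weight c = card {i. i < dim_vec c \<and> c $ i \<noteq> 0}"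

definition nonzero_weights :: "bit vec set \<Rightarrow> nat set" where
  "nonzero_weights C = weight ` C - {0}"

definition full_length :: "nat \<Rightarrow> bit vec set \<Rightarrow> bool" where
  "full_length n C \<longleftrightarrow> \<not> (\<exists>i<n. \<forall>c\<in>C. c $ i = 0)"

definition projective :: "nat \<Rightarrow> bit vec set \<Rightarrow> bool" where
  "projective n C \<longleftrightarrow>
     full_length n C \<and> \<not> (\<exists>i<n. \<exists>j<n. i \<noteq> j \<and> (\<forall>c\<in>C. c $ i = c $ j))"

definition three_weight :: "bit vec set \<Rightarrow> bool" where
  "three_weight C \<longleftrightarrow> card (nonzero_weights C) = 3"

definition divisible_code :: "nat \<Rightarrow> bit vec set \<Rightarrow> bool" where
  "divisible_code \<Delta> C \<longleftrightarrow> (\<forall>c\<in>C. \<Delta> dvd weight c)"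

definition admissible_code :: "nat \<Rightarrow> nat \<Rightarrow> nat \<Rightarrow> bit vec set \<Rightarrow> bool" where
  "admissible_code a n k C \<longleftrightarrow>
     binary_code n k C \<and> projective n C \<and> three_weight C \<and>
     (\<exists>w1 w2 w3. nonzero_weights C = {w1, w2, w3} \<and> w1 < w2 \<and> w2 < w3 \<and>
        real w1 + real w2 + real w3 = 3 * real n / 2 \<and> real w2 = real n / 2) \<and>
     \<not> divisible_code (2 ^ a) C"

definition admissible_dims :: "nat \<Rightarrow> nat set" where
  "admissible_dims a = {k. \<exists>n C. admissible_code a n k C}"

definition admissible_lengths :: "nat \<Rightarrow> nat set" where
  "admissible_lengths a = {n. \<exists>k C. admissible_code a n k C}"

text \<open>\<^const>\<open>Max\<close> carries no information on an infinite or empty set; the following two definitions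
  are the intended maxima only when the sets above are finite and non-empty.\<close>

definition K_max :: "nat \<Rightarrow> nat" where
  "K_max a = Max (admissible_dims a)"

definition N_max :: "nat \<Rightarrow> nat" where
  "N_max a = Max (admissible_lengths a)"

end

theory Submission
  imports Defs
begin

text \<open>
  For a word \<open>c\<close> of length \<open>n\<close> put \<open>X c = n - 2 * weight c\<close>, the sum of the signs \<open>(-1)^c\<^sub>i\<close>.
  The conditions on the weights say exactly that \<open>X\<close> takes the values \<open>s\<close>, \<open>0\<close>, \<open>-s\<close> and no others
  on the non-zero codewords, where \<open>s = w3 - w1\<close>; moreover \<open>X 0 = n\<close>. Write \<open>N = 2 ^ k\<close> for the
  number of codewords.

  \<^bold>\<open>Upper bounds.\<close> Summed over the code, the sign at one coordinate gives \<open>0\<close>, and so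
  does the product of the signs at two distinct coordinates, by linearity and projectivity; a product
  of three signs gives \<open>0\<close> or \<open>N\<close>. This gives the moments \<open>\<Sum>X = 0\<close>, \<open>\<Sum>X\<^sup>2 = N n\<close>, \<open>N dvd \<Sum>X^3\<close> and the inversion formula
  \<open>\<Sum>(-1)^c\<^sub>i X c = N\<close>. The first moment shows that \<open>s\<close> divides \<open>n\<close>, hence every \<open>X c\<close>; by inversion
  \<open>s\<close> divides \<open>N\<close> and so is a power of two. If it were at least \<open>2 ^ (a + 1)\<close>, all weights would be
  divisible by \<open>2 ^ a\<close>; therefore \<open>s \<le> 2 ^ a\<close>. The sum of \<open>X\<^sup>2 + s X\<close> over the non-zero codewords is
  \<open>n (N - n - s)\<close>, and it is positive because \<open>w1\<close> occurs, so \<open>n + s < N\<close>; as \<open>s \<ge> 2\<close>, the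
  bound on the length follows. For the dimension, \<open>X\<^sup>2 \<le> s\<^sup>2\<close> on non-zero codewords gives
  \<open>n (N - n) \<le> s\<^sup>2 (N - 1)\<close>, so that \<open>n\<close> or \<open>N - n\<close> is below \<open>2 s\<^sup>2\<close> unless \<open>N\<close> itself is below \<open>4 s\<^sup>2\<close>.
  Since \<open>X^3 = s\<^sup>2 X\<close> on non-zero codewords, \<open>N\<close> divides the cubic \<open>n^3 - s\<^sup>2 n\<close>, which modulo \<open>N\<close> is
  odd under \<open>n \<mapsto> N - n\<close>. So \<open>N\<close> divides a positive number of size at most \<open>8 s^6\<close>, and
  \<open>N < 2 s^8 \<le> 2 ^ (8 a + 1)\<close> (\<open>field_size_bound\<close>, \<open>admissible_code_bounds\<close>).

  \<^bold>\<open>Lower bounds.\<close> Let \<open>V\<close> be the space of bit vectors of length \<open>a\<close>. Inside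
  the space of triples \<open>(e, x, y)\<close>, of dimension \<open>2 a + 1\<close>, remove \<open>{0} \<times> V \<times> {0}\<close> and \<open>{1} \<times> {0} \<times> V\<close>,
  and evaluate all linear functionals on the remaining points. The two removed pieces are parallel to
  complementary subspaces of order \<open>s = 2 ^ a\<close>, so a non-zero functional has character sum \<open>0\<close> or
  \<open>\<plusminus>s\<close> on their union, and the negative of that value on the remaining points (\<open>sum_chi_pairing\<close>,
  \<open>exists_admissible_code\<close>). This one code witnesses both lower bounds.
\<close>

section \<open>Binary codes as additively closed sets of vectors\<close>

text \<open>Coordinates with respect to a basis identify the space with the functions from the basis to
  the field.\<close>

lemma (in vectorspace) card_carrier_eq_power_dim:
  assumes fin: "finite (carrier V)"
  shows "card (carrier V) = card (carrier K) ^ dim"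
proof -
  have "span (carrier V) = carrier V"
    using in_own_span[of "carrier V"] span_closed[of "carrier V"] by blast
  then have "fin_dim"
    unfolding fin_dim_def using fin by blast
  then obtain B where B: "finite B" "basis B"
    using finite_basis_exists by blast
  then have BV: "B \<subseteq> carrier V"
    unfolding basis_def by blast
  have unique: "\<exists>!a. a \<in> B \<rightarrow>\<^sub>E carrier K \<and> lincomb a B = v" if "v \<in> carrier V" for v
    using basis_criterion[OF B(1) BV] B(2) that by blast
  have "bij_betw (\<lambda>a. lincomb a B) (B \<rightarrow>\<^sub>E carrier K) (carrier V)"
  proof (rule bij_betwI')
    fix a b
    assume ab: "a \<in> B \<rightarrow>\<^sub>E carrier K" "b \<in> B \<rightarrow>\<^sub>E carrier K"
    have "lincomb a B \<in> carrier V"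
      using ab(1) BV by (intro lincomb_closed) auto
    from unique[OF this] show "(lincomb a B = lincomb b B) = (a = b)"
      using ab by metis
  next
    fix a
    assume "a \<in> B \<rightarrow>\<^sub>E carrier K"
    then show "lincomb a B \<in> carrier V"
      using BV by (intro lincomb_closed) auto
  next
    fix v
    assume "v \<in> carrier V"
    from unique[OF this] show "\<exists>a\<in>B \<rightarrow>\<^sub>E carrier K. v = lincomb a B"
      by blast
  qed
  then have "card (carrier V) = card (B \<rightarrow>\<^sub>E carrier K)"
    by (rule bij_betw_same_card[symmetric])
  also have "\<dots> = card (carrier K) ^ card B"
    by (rule card_funcsetE[OF B(1)])
  also have "card B = dim"
    using dim_basis B by simp
  finally show ?thesis .
qed

lemma UNIV_bit: "(UNIV :: bit set) = {0, 1}"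
  using bit_not_zero_iff by blast

lemma finite_carrier_vec_bit: "finite (carrier_vec n :: bit vec set)"
proof -
  have "v \<in> vec n ` ({..<n} \<rightarrow>\<^sub>E UNIV)" if "v \<in> carrier_vec n" for v :: "bit vec"
  proof
    show "v = vec n (\<lambda>i\<in>{..<n}. v $ i)"
      using that by (intro eq_vecI) auto
  qed auto
  moreover have "finite ({..<n} \<rightarrow>\<^sub>E (UNIV :: bit set))"
    by (intro finite_PiE) (auto simp: UNIV_bit)
  ultimately show ?thesis
    by (meson finite_imageI finite_subset subsetI)
qed

lemma subspace_bit_vec_iff:
  "VectorSpace.subspace class_ring C (module_vec TYPE(bit) n) \<longleftrightarrow>
     C \<subseteq> carrier_vec n \<and> 0\<^sub>v n \<in> C \<and> (\<forall>x\<in>C. \<forall>y\<in>C. x + y \<in> C)"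
  (is "?L \<longleftrightarrow> ?R")
proof
  assume ?L
  then have "submodule class_ring C (module_vec TYPE(bit) n)"
    by (simp add: VectorSpace.subspace_def)
  then show ?R
    by (auto simp: submodule_def module_vec_simps)
next
  assume R: ?R
  interpret vectorspace "class_ring :: bit ring" "module_vec TYPE(bit) n"
    by (rule vec_vs)
  have "c \<cdot>\<^sub>v v \<in> C" if "v \<in> C" for c :: bit and v
  proof (cases "c = 0")
    case True
    have "v \<in> carrier_vec n"
      using that R by blast
    then have "c \<cdot>\<^sub>v v = 0\<^sub>v n"
      using True by (intro eq_vecI) auto
    then show ?thesis
      using R by simp
  qed (use that in simp)
  then have "submodule class_ring C (module_vec TYPE(bit) n)"
    using R module_axioms by (auto simp: submodule_def module_vec_simps)
  then show ?L
    using vectorspace_axioms by (simp add: VectorSpace.subspace_def)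
qed

text \<open>Over the field with two elements scalar multiplication imposes nothing beyond additive
  closure, and the number of elements determines the dimension. This form is the only access to the
  linear structure that the counting arguments use.\<close>

lemma binary_code_iff:
  "binary_code n k C \<longleftrightarrow>
     C \<subseteq> carrier_vec n \<and> 0\<^sub>v n \<in> C \<and> (\<forall>x\<in>C. \<forall>y\<in>C. x + y \<in> C) \<and> card C = 2 ^ k"
proof (cases "VectorSpace.subspace class_ring C (module_vec TYPE(bit) n)")
  case True
  interpret V: vectorspace "class_ring :: bit ring" "module_vec TYPE(bit) n"
    by (rule vec_vs)
  interpret W: vectorspace "class_ring :: bit ring" "(module_vec TYPE(bit) n)\<lparr>carrier := C\<rparr>"
    by (rule V.subspace_is_vs[OF True])
  have "finite C"
    using True subspace_bit_vec_iff finite_carrier_vec_bit finite_subset by metis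
  then have "card C = 2 ^ W.dim"
    using W.card_carrier_eq_power_dim by (simp add: UNIV_bit numeral_2_eq_2)
  then show ?thesis
    using True unfolding binary_code_def subspace_bit_vec_iff by auto
next
  case False
  then show ?thesis
    unfolding binary_code_def subspace_bit_vec_iff by blast
qed

lemma card_carrier_vec_bit: "card (carrier_vec n :: bit vec set) = 2 ^ n"
proof -
  interpret vec_space "TYPE(bit)" n .
  show ?thesis
    using card_carrier_eq_power_dim finite_carrier_vec_bit dim_is_n
    by (simp add: UNIV_bit module_vec_simps numeral_2_eq_2)
qed

section \<open>Character sums\<close>

text \<open>The non-trivial additive character of the field with two elements.\<close>

definition chi :: "bit \<Rightarrow> int" where
  "chi b = (if b = 0 then 1 else - 1)"

lemma chi_0 [simp]: "chi 0 = 1"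
  by (simp add: chi_def)

lemma chi_add: "chi (x + y) = chi x * chi y"
  by (cases x; cases y) (simp_all add: chi_def)

lemma add_self_bit_vec:
  fixes x y :: "bit vec"
  assumes "x \<in> carrier_vec n" "y \<in> carrier_vec n"
  shows "x + y + y = x"
proof (rule eq_vecI)
  fix i
  assume "i < dim_vec x"
  then show "(x + y + y) $ i = x $ i"
    using assms by (cases "y $ i") auto
qed (use assms in auto)

text \<open>Orthogonality of characters: if \<open>f g = 1\<close>, the involution \<open>x \<mapsto> x + g\<close> of \<open>G\<close> flips
  every sign.\<close>

lemma sum_chi_additive:
  fixes G :: "bit vec set"
  assumes G: "G \<subseteq> carrier_vec n" "\<And>x y. x \<in> G \<Longrightarrow> y \<in> G \<Longrightarrow> x + y \<in> G"
    and add: "\<And>x y. x \<in> G \<Longrightarrow> y \<in> G \<Longrightarrow> f (x + y) = f x + f y"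
  shows "(\<Sum>x\<in>G. chi (f x)) = (if \<forall>x\<in>G. f x = 0 then int (card G) else 0)"
proof (cases "\<forall>x\<in>G. f x = 0")
  case True
  then show ?thesis
    by simp
next
  case False
  then obtain g where g: "g \<in> G" "f g = 1"
    by auto
  have "x + g + g = x" if "x \<in> G" for x
    using that g(1) G(1) by (intro add_self_bit_vec[of _ n]) auto
  then have "(\<Sum>x\<in>G. chi (f x)) = (\<Sum>x\<in>G. chi (f (x + g)))"
    using g(1) G(2)
    by (intro sum.reindex_bij_witness[where i = "\<lambda>x. x + g" and j = "\<lambda>x. x + g"]) simp_all
  also have "\<dots> = (\<Sum>x\<in>G. - chi (f x))"
    using g by (intro sum.cong refl) (simp only: add chi_add, simp add: chi_def)
  also have "\<dots> = - (\<Sum>x\<in>G. chi (f x))"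
    by (rule sum_negf)
  finally have "(\<Sum>x\<in>G. chi (f x)) = 0"
    by simp
  then show ?thesis
    using False by (simp only: if_False)
qed

definition char_sum :: "bit vec \<Rightarrow> int" where
  "char_sum c = (\<Sum>i<dim_vec c. chi (c $ i))"

lemma char_sum_eq_weight: "char_sum c = int (dim_vec c) - 2 * int (weight c)"
proof -
  have "(\<Sum>i<dim_vec c. of_bool (c $ i \<noteq> 0)) = int (card ({..<dim_vec c} \<inter> {i. c $ i \<noteq> 0}))"
    by (simp add: sum_of_bool_eq del: bit_not_zero_iff)
  also have "{..<dim_vec c} \<inter> {i. c $ i \<noteq> 0} = {i. i < dim_vec c \<and> c $ i \<noteq> 0}"
    by blast
  finally have "(\<Sum>i<dim_vec c. of_bool (c $ i \<noteq> 0)) = int (weight c)"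
    by (simp only: weight_def)
  moreover have "chi b = 1 - 2 * of_bool (b \<noteq> 0)" for b
    by (simp add: chi_def)
  ultimately show ?thesis
    unfolding char_sum_def by (simp only: sum_subtractf sum_distrib_left[symmetric]) simp
qed

lemma weight_eq_0_iff: "c \<in> carrier_vec n \<Longrightarrow> weight c = 0 \<longleftrightarrow> c = 0\<^sub>v n"
  unfolding weight_def by (auto intro: eq_vecI)

section \<open>Power moments of a projective code\<close>

locale projective_binary_code =
  fixes n k :: nat and C :: "bit vec set"
  assumes code: "binary_code n k C" and proj: "projective n C"
begin

lemma code_closed:
  "C \<subseteq> carrier_vec n" "0\<^sub>v n \<in> C" "x \<in> C \<Longrightarrow> y \<in> C \<Longrightarrow> x + y \<in> C" "card C = 2 ^ k"
  using code unfolding binary_code_iff by auto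

lemma finite_code: "finite C"
  using code_closed(4) card.infinite by fastforce

lemma dim_codeword [simp]: "c \<in> C \<Longrightarrow> dim_vec c = n"
  using code_closed(1) by auto

lemma coordinate_add: "x \<in> C \<Longrightarrow> y \<in> C \<Longrightarrow> i < n \<Longrightarrow> (x + y) $ i = x $ i + y $ i"
  by simp

lemma char_sum_codeword: "c \<in> C \<Longrightarrow> char_sum c = (\<Sum>i<n. chi (c $ i))"
  by (simp add: char_sum_def)

lemma sum_chi_functional:
  assumes "\<And>x y. x \<in> C \<Longrightarrow> y \<in> C \<Longrightarrow> f (x + y) = f x + f y"
  shows "(\<Sum>c\<in>C. chi (f c)) = (if \<forall>c\<in>C. f c = 0 then 2 ^ k else 0)"
  using sum_chi_additive[of C n f] code_closed assms by simp

lemma sum_chi_coordinate: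
  assumes "i < n"
  shows "(\<Sum>c\<in>C. chi (c $ i)) = 0"
  using proj assms
  by (subst sum_chi_functional) (auto simp: projective_def full_length_def)

text \<open>Here projectivity enters: distinct coordinates give distinct functionals on the code.\<close>

lemma sum_chi_two_coordinates:
  assumes "i < n" "j < n"
  shows "(\<Sum>c\<in>C. chi (c $ i) * chi (c $ j)) = (if i = j then 2 ^ k else 0)"
proof -
  have "(\<Sum>c\<in>C. chi (c $ i) * chi (c $ j)) = (\<Sum>c\<in>C. chi (c $ i + c $ j))"
    by (simp only: chi_add)
  also have "\<dots> = (if \<forall>c\<in>C. c $ i + c $ j = 0 then 2 ^ k else 0)"
    by (rule sum_chi_functional) (simp only: coordinate_add assms ac_simps)
  also have "(\<forall>c\<in>C. c $ i + c $ j = 0) \<longleftrightarrow> (\<forall>c\<in>C. c $ i = c $ j)"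
    by (simp only: eq_iff_diff_eq_0[of "_ $ i"] minus_bit_def)
  also have "(\<forall>c\<in>C. c $ i = c $ j) \<longleftrightarrow> i = j"
    using proj assms unfolding projective_def by blast
  finally show ?thesis .
qed

text \<open>Three coordinate functionals may well add up to zero on the code, so only divisibility
  survives.\<close>

lemma dvd_sum_chi_three_coordinates:
  assumes "i < n" "j < n" "l < n"
  shows "2 ^ k dvd (\<Sum>c\<in>C. chi (c $ i) * chi (c $ j) * chi (c $ l))"
proof -
  have "(\<Sum>c\<in>C. chi (c $ i) * chi (c $ j) * chi (c $ l))
      = (\<Sum>c\<in>C. chi (c $ i + c $ j + c $ l))"
    by (simp only: chi_add)
  also have "\<dots> = (if \<forall>c\<in>C. c $ i + c $ j + c $ l = 0 then 2 ^ k else 0)"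
    by (rule sum_chi_functional) (simp only: coordinate_add assms ac_simps)
  finally show ?thesis
    by simp
qed

text \<open>Every moment arises by expanding one factor \<open>char_sum c\<close> at a time into its signs.\<close>

lemma sum_char_sum_mult:
  "(\<Sum>c\<in>C. char_sum c * g c) = (\<Sum>i<n. \<Sum>c\<in>C. chi (c $ i) * g c)"
proof -
  have "(\<Sum>c\<in>C. char_sum c * g c) = (\<Sum>c\<in>C. \<Sum>i<n. chi (c $ i) * g c)"
    by (simp add: char_sum_codeword sum_distrib_right)
  also have "\<dots> = (\<Sum>i<n. \<Sum>c\<in>C. chi (c $ i) * g c)"
    by (rule sum.swap)
  finally show ?thesis .
qed

lemma first_moment: "(\<Sum>c\<in>C. char_sum c) = 0"
  using sum_char_sum_mult[of "\<lambda>_. 1"] by (simp add: sum_chi_coordinate)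

text \<open>Fourier inversion at the \<open>i\<close>-th column of a generator matrix, for the indicator function of
  the set of columns.\<close>

lemma inversion:
  assumes "i < n"
  shows "(\<Sum>c\<in>C. chi (c $ i) * char_sum c) = 2 ^ k"
proof -
  have "(\<Sum>c\<in>C. chi (c $ i) * char_sum c) = (\<Sum>j<n. \<Sum>c\<in>C. chi (c $ j) * chi (c $ i))"
    using sum_char_sum_mult[of "\<lambda>c. chi (c $ i)"] by (simp add: mult.commute)
  also have "\<dots> = (\<Sum>j<n. if j = i then 2 ^ k else 0)"
    using assms by (intro sum.cong) (auto simp: sum_chi_two_coordinates)
  finally show ?thesis
    using assms by simp
qed

lemma second_moment: "(\<Sum>c\<in>C. char_sum c ^ 2) = 2 ^ k * int n"
  using sum_char_sum_mult[of char_sum] by (simp add: inversion power2_eq_square)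

lemma dvd_third_moment: "2 ^ k dvd (\<Sum>c\<in>C. char_sum c ^ 3)"
proof -
  have "2 ^ k dvd (\<Sum>c\<in>C. char_sum c * (chi (c $ i) * chi (c $ j)))" if "i < n" "j < n" for i j
    unfolding sum_char_sum_mult using that
    by (intro dvd_sum[where A = "{..<n}"]) (simp add: dvd_sum_chi_three_coordinates flip: mult.assoc)
  then have "2 ^ k dvd (\<Sum>c\<in>C. chi (c $ i) * (char_sum c * chi (c $ j)))" if "i < n" "j < n" for i j
    using that by (simp only: mult.left_commute)
  then have "2 ^ k dvd (\<Sum>c\<in>C. char_sum c * (char_sum c * chi (c $ j)))" if "j < n" for j
    unfolding sum_char_sum_mult using that by (intro dvd_sum[where A = "{..<n}"]) simp
  then have "2 ^ k dvd (\<Sum>c\<in>C. chi (c $ j) * (char_sum c * char_sum c))" if "j < n" for j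
    using that by (simp only: mult.commute mult.left_commute)
  then have "2 ^ k dvd (\<Sum>c\<in>C. char_sum c * (char_sum c * char_sum c))"
    unfolding sum_char_sum_mult by (intro dvd_sum[where A = "{..<n}"]) simp
  then show ?thesis
    by (simp only: power3_eq_cube mult.assoc)
qed

end

section \<open>The upper bounds\<close>

text \<open>The cubic factors as \<open>x (x - s) (x + s)\<close>, which is positive for \<open>x > s\<close>; a positive multiple
  of \<open>N\<close> is at least \<open>N\<close>.\<close>

lemma cubic_divisor_bound:
  fixes N x s :: int
  assumes "N dvd x ^ 3 - s\<^sup>2 * x" "0 < s" "s < x" "x < 2 * s\<^sup>2"
  shows "N < 8 * s ^ 6"
proof -
  have "s\<^sup>2 < x\<^sup>2"
    using assms by (intro power_strict_mono) auto
  then have "0 < x * (x\<^sup>2 - s\<^sup>2)"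
    using assms by (intro mult_pos_pos) auto
  then have pos: "0 < x ^ 3 - s\<^sup>2 * x"
    by (simp add: algebra_simps power2_eq_square power3_eq_cube)
  then have "N \<le> x ^ 3 - s\<^sup>2 * x"
    using assms(1) zdvd_imp_le by blast
  also have "\<dots> \<le> x ^ 3"
    using assms by simp
  also have "\<dots> < (2 * s\<^sup>2) ^ 3"
    using assms by (intro power_strict_mono) auto
  also have "\<dots> = 8 * s ^ 6"
    by (simp add: power_mult_distrib flip: power_mult)
  finally show ?thesis .
qed

text \<open>The second-moment inequality is quadratic in \<open>n\<close> and symmetric under \<open>n \<mapsto> N - n\<close>. It fails
  in the middle of the range once \<open>N\<close> is large compared with \<open>s\<^sup>2\<close>, so \<open>n\<close> is close to \<open>0\<close> or to \<open>N\<close>.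
  Near either end the cubic that \<open>N\<close> divides is too small.\<close>

lemma field_size_bound:
  fixes N n s :: int
  assumes s: "2 \<le> s" and n: "s < n" "n + s < N"
    and moment2: "n * (N - n) \<le> s\<^sup>2 * (N - 1)"
    and moment3: "N dvd n ^ 3 - s\<^sup>2 * n"
  shows "N < 2 * s ^ 8"
proof -
  have s26: "2\<^sup>2 \<le> s\<^sup>2" and s24: "2 ^ 4 \<le> s ^ 4"
    using s by (intro power_mono; simp)+
  have s68: "8 * s ^ 6 \<le> 2 * s ^ 8"
    using mult_right_mono[OF s26, of "2 * s ^ 6"] s
    by (simp add: mult.left_commute[of "s\<^sup>2"] flip: power_add)
  have s28: "4 * s\<^sup>2 < 2 * s ^ 8"
  proof -
    have "4 * s\<^sup>2 < 8 * (s ^ 4 * s\<^sup>2)"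
      using mult_right_mono[OF s24, of "s\<^sup>2"] s by (simp add: power2_eq_square)
    then show ?thesis
      using s68 by (simp flip: power_add)
  qed
  have moment3': "N dvd (N - n) ^ 3 - s\<^sup>2 * (N - n)"
  proof -
    have "(N - n) ^ 3 - s\<^sup>2 * (N - n)
        = N * (N\<^sup>2 - 3 * N * n + 3 * n\<^sup>2 - s\<^sup>2) - (n ^ 3 - s\<^sup>2 * n)"
      by (simp add: algebra_simps power2_eq_square power3_eq_cube)
    then show ?thesis
      using moment3 by (metis dvd_diff dvd_triv_left)
  qed
  consider "n < 2 * s\<^sup>2" | "N - n < 2 * s\<^sup>2" | "2 * s\<^sup>2 \<le> n" "2 * s\<^sup>2 \<le> N - n"
    by linarith
  then show ?thesis
  proof cases
    case 1
    then show ?thesis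
      using cubic_divisor_bound[OF moment3] s n s68 by linarith
  next
    case 2
    then show ?thesis
      using cubic_divisor_bound[OF moment3'] s n s68 by linarith
  next
    case 3
    then have "0 \<le> (n - 2 * s\<^sup>2) * (N - n - 2 * s\<^sup>2)"
      by simp
    then have "s\<^sup>2 * (2 * N) - 4 * (s\<^sup>2 * s\<^sup>2) \<le> n * (N - n)"
      by (simp add: algebra_simps)
    with moment2 have "s\<^sup>2 * (N + 1) \<le> s\<^sup>2 * (4 * s\<^sup>2)"
      by (simp add: algebra_simps)
    then have "N + 1 \<le> 4 * s\<^sup>2"
      using s by (simp add: mult_le_cancel_left)
    then show ?thesis
      using s28 by linarith
  qed
qed

text \<open>The common difference of the weights is \<open>s / 2\<close>. The middle weight and the sum condition
  force \<open>w1 + w3 = n\<close>, which makes the character sums symmetric about \<open>0\<close>.\<close>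

lemma admissible_code_bounds:
  assumes adm: "admissible_code a n k C"
  shows "k \<le> 8 * a + 1" and "n + 3 \<le> 2 ^ k"
proof -
  interpret projective_binary_code n k C
    using adm unfolding admissible_code_def by unfold_locales auto
  obtain w1 w2 w3 where W: "nonzero_weights C = {w1, w2, w3}" "w1 < w2" "w2 < w3"
      "real w1 + real w2 + real w3 = 3 * real n / 2" "real w2 = real n / 2"
    and nondiv: "\<not> divisible_code (2 ^ a) C"
    using adm unfolding admissible_code_def by blast
  have w: "n = 2 * w2" "w1 + w3 = n"
    using W(4,5) by linarith+
  have w1_pos: "0 < w1"
    using W(1) unfolding nonzero_weights_def by auto
  define s where "s = int n - 2 * int w1"
  have s: "2 \<le> s" "s < int n"
    using w W(2) w1_pos by (auto simp: s_def)
  define N :: int where "N = 2 ^ k"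
  define C' where "C' = C - {0\<^sub>v n}"
  have fin': "finite C'"
    using finite_code by (simp add: C'_def)
  have cardC': "int (card C') = N - 1"
    using code_closed(2,4) finite_code by (simp add: C'_def N_def of_nat_diff)
  have at_zero: "char_sum (0\<^sub>v n) = int n"
    by (simp add: char_sum_def)
  have split_zero: "(\<Sum>c\<in>C. f c) = f (0\<^sub>v n) + (\<Sum>c\<in>C'. f c)" for f :: "bit vec \<Rightarrow> int"
    using code_closed(2) finite_code by (simp add: C'_def sum.remove)
  have spectrum: "char_sum c \<in> {s, 0, - s}" if "c \<in> C'" for c
  proof -
    have "c \<in> C" "weight c \<noteq> 0"
      using that weight_eq_0_iff code_closed(1) by (auto simp: C'_def)
    then have "weight c \<in> {w1, w2, w3}"
      unfolding W(1)[symmetric] nonzero_weights_def by auto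
    then show ?thesis
      using w \<open>c \<in> C\<close> by (auto simp: char_sum_eq_weight s_def)
  qed
  obtain c1 where c1: "c1 \<in> C'" "char_sum c1 = s"
  proof -
    have "w1 \<in> nonzero_weights C"
      using W(1) by simp
    then obtain c where "c \<in> C" "weight c = w1"
      unfolding nonzero_weights_def by auto
    moreover have "c \<noteq> 0\<^sub>v n"
      using \<open>weight c = w1\<close> w1_pos weight_eq_0_iff[of c n] by auto
    ultimately show ?thesis
      using that[of c] by (simp add: C'_def char_sum_eq_weight s_def)
  qed
  have m1: "(\<Sum>c\<in>C'. char_sum c) = - int n"
    using first_moment split_zero[of char_sum] at_zero by simp
  have m2: "(\<Sum>c\<in>C'. char_sum c ^ 2) = int n * (N - int n)"
    using second_moment split_zero[of "\<lambda>c. char_sum c ^ 2"] at_zero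
    by (simp add: N_def algebra_simps power2_eq_square)
  have m3: "(\<Sum>c\<in>C. char_sum c ^ 3) = int n ^ 3 - s\<^sup>2 * int n"
  proof -
    have "char_sum c ^ 3 = s\<^sup>2 * char_sum c" if "c \<in> C'" for c
      using spectrum[OF that] by (auto simp: power2_eq_square power3_eq_cube)
    then have "(\<Sum>c\<in>C'. char_sum c ^ 3) = s\<^sup>2 * (\<Sum>c\<in>C'. char_sum c)"
      by (simp add: sum_distrib_left)
    then show ?thesis
      using split_zero[of "\<lambda>c. char_sum c ^ 3"] at_zero m1 by simp
  qed
  have s_dvd': "s dvd char_sum c" if "c \<in> C'" for c
    using spectrum[OF that] by auto
  have s_dvd_n: "s dvd int n"
    using m1 s_dvd' by (metis dvd_minus_iff dvd_sum)
  have s_dvd: "s dvd char_sum c" if "c \<in> C" for c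
    using s_dvd' s_dvd_n at_zero that by (cases "c = 0\<^sub>v n") (auto simp: C'_def)
  have "0 < n"
    using w w1_pos by simp
  have "s dvd (\<Sum>c\<in>C. chi (c $ 0) * char_sum c)"
    using s_dvd by (intro dvd_sum dvd_mult)
  then have "s dvd 2 ^ k"
    unfolding inversion[OF \<open>0 < n\<close>] .
  then obtain b where b: "s = 2 ^ b"
  proof -
    have "nat s dvd 2 ^ k"
      using \<open>s dvd 2 ^ k\<close> s(1) by (simp add: nat_dvd_iff)
    then obtain b where "nat s = 2 ^ b"
      using divides_primepow_nat[OF two_is_prime_nat] by blast
    then have "s = 2 ^ b"
      using s(1) by (metis int_nat_eq nat_numeral_as_int nat_power_eq of_nat_numeral of_nat_power order.trans zero_le_numeral)
    then show ?thesis
      by (rule that)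
  qed
  \<comment> \<open>Since \<open>s\<close> divides \<open>n\<close> and every \<open>n - 2 * weight c\<close>, it divides every doubled weight.\<close>
  have "b \<le> a"
  proof (rule ccontr)
    assume "\<not> b \<le> a"
    then have "(2::int) ^ Suc a dvd s"
      unfolding b by (intro le_imp_power_dvd) simp
    then have "2 * 2 ^ a dvd 2 * int (weight c)" if "c \<in> C" for c
      using s_dvd[OF that] s_dvd_n that char_sum_eq_weight[of c]
      by (metis add_diff_cancel_left' diff_add_cancel dim_codeword dvd_diff dvd_trans power_Suc)
    then have "int (2 ^ a) dvd int (weight c)" if "c \<in> C" for c
      using that by simp
    then show False
      using nondiv unfolding divisible_code_def int_dvd_int_iff by blast
  qed
  \<comment> \<open>\<open>X\<^sup>2 + s X\<close> vanishes for \<open>X = 0\<close> and \<open>X = - s\<close> and is positive for \<open>X = s\<close>.\<close>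
  have gap: "int n + s < N"
  proof -
    have "0 < (\<Sum>c\<in>C'. char_sum c ^ 2 + s * char_sum c)"
    proof (rule sum_pos2[OF fin' c1(1)])
      show "0 < char_sum c1 ^ 2 + s * char_sum c1"
        using s c1 by (simp add: add_pos_pos)
      show "0 \<le> char_sum c ^ 2 + s * char_sum c" if "c \<in> C'" for c
        using spectrum[OF that] by (auto simp: power2_eq_square)
    qed
    also have "\<dots> = int n * (N - int n - s)"
      using m1 m2 by (simp add: sum.distrib algebra_simps flip: sum_distrib_left)
    finally show ?thesis
      using \<open>0 < n\<close> by (simp add: zero_less_mult_iff)
  qed
  have "int n * (N - int n) \<le> s\<^sup>2 * (N - 1)"
  proof -
    have "(\<Sum>c\<in>C'. char_sum c ^ 2) \<le> of_nat (card C') * s\<^sup>2"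
      using spectrum by (intro sum_bounded_above) fastforce
    then show ?thesis
      using m2 cardC' by (simp add: mult.commute)
  qed
  moreover have "N dvd int n ^ 3 - s\<^sup>2 * int n"
    using dvd_third_moment m3 by (simp add: N_def)
  ultimately have "N < 2 * s ^ 8"
    using field_size_bound s(1,2) gap by blast
  also have "\<dots> = 2 ^ (8 * b + 1)"
    by (simp add: b mult.commute flip: power_mult)
  finally have "(2::int) ^ k < 2 ^ (8 * b + 1)"
    by (simp only: N_def)
  then have "k < 8 * b + 1"
    by (rule power_less_imp_less_exp[rotated]) simp
  then show "k \<le> 8 * a + 1"
    using \<open>b \<le> a\<close> by linarith
  have "int (n + 3) \<le> int (2 ^ k)"
    using gap s(1) by (simp add: N_def)
  then show "n + 3 \<le> 2 ^ k"
    by linarith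
qed

section \<open>A code attaining the lower bounds\<close>

type_synonym point = "bit \<times> bit vec \<times> bit vec"

text \<open>The complement of \<open>{0} \<times> V \<times> {0} \<union> {1} \<times> {0} \<times> V\<close> in the space of all triples, written as a
  disjoint union of products so that character sums factor. These points are the columns of a
  generator matrix.\<close>

definition point_set :: "nat \<Rightarrow> point set" where
  "point_set a =
     {0} \<times> carrier_vec a \<times> (carrier_vec a - {0\<^sub>v a}) \<union>
     {1} \<times> (carrier_vec a - {0\<^sub>v a}) \<times> carrier_vec a"

text \<open>The space of triples serves both as the set of messages and, through \<open>pairing\<close> below, as the
  space of points on which a message acts as a linear functional.\<close>

definition messages :: "nat \<Rightarrow> point set" where
  "messages a = UNIV \<times> carrier_vec a \<times> carrier_vec a"

fun pairing :: "point \<Rightarrow> point \<Rightarrow> bit" where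
  "pairing (d, u, v) (e, x, y) = d * e + u \<bullet> x + v \<bullet> y"

fun msg_add :: "point \<Rightarrow> point \<Rightarrow> point" where
  "msg_add (d, u, v) (d', u', v') = (d + d', u + u', v + v')"

lemma point_set_subset: "point_set a \<subseteq> messages a"
  by (auto simp: point_set_def messages_def)

lemma finite_point_set: "finite (point_set a)"
  by (simp add: point_set_def finite_carrier_vec_bit)

lemma card_messages: "card (messages a) = 2 ^ (2 * a + 1)"
  by (simp add: messages_def card_cartesian_product card_carrier_vec_bit UNIV_bit
      mult_2 power_add)

lemma card_point_set: "int (card (point_set a)) = 2 * 2 ^ a * (2 ^ a - 1)"
proof -
  have "card (carrier_vec a - {0\<^sub>v a :: bit vec}) = 2 ^ a - 1"
    by (simp add: card_carrier_vec_bit finite_carrier_vec_bit)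
  then have "card (point_set a) = 2 ^ a * (2 ^ a - 1) + (2 ^ a - 1) * 2 ^ a"
    unfolding point_set_def
    by (subst card_Un_disjoint)
      (auto simp: finite_carrier_vec_bit card_cartesian_product card_carrier_vec_bit)
  then show ?thesis
    by (simp add: of_nat_diff)
qed

lemma msg_add_closed: "m \<in> messages a \<Longrightarrow> m' \<in> messages a \<Longrightarrow> msg_add m m' \<in> messages a"
  by (auto simp: messages_def)

lemma pairing_msg_add:
  assumes "m \<in> messages a" "m' \<in> messages a" "p \<in> messages a"
  shows "pairing (msg_add m m') p = pairing m p + pairing m' p"
  using assms by (auto simp: messages_def add_scalar_prod_distrib[of _ a] algebra_simps)

lemma msg_add_eq_zero:
  assumes "m \<in> messages a" "m' \<in> messages a" "msg_add m m' = (0, 0\<^sub>v a, 0\<^sub>v a)"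
  shows "m = m'"
proof -
  obtain d u v d' u' v' where m: "m = (d, u, v)" "m' = (d', u', v')"
    by (metis prod_cases3)
  have carrier: "u \<in> carrier_vec a" "u' \<in> carrier_vec a" "v \<in> carrier_vec a" "v' \<in> carrier_vec a"
    using assms(1,2) m by (auto simp: messages_def)
  have zero: "d + d' = 0" "u + u' = 0\<^sub>v a" "v + v' = 0\<^sub>v a"
    using assms(3) m by (simp_all only: msg_add.simps prod.inject)
  have "d = d'"
    using zero(1) by (cases d; cases d') simp_all
  moreover have "u = u'"
    using add_self_bit_vec[OF carrier(1,2)] carrier(2) zero(2) by simp
  moreover have "v = v'"
    using add_self_bit_vec[OF carrier(3,4)] carrier(4) zero(3) by simp
  ultimately show ?thesis
    using m by simp
qed

lemma sum_chi_scalar_prod: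
  assumes u: "u \<in> carrier_vec a"
  shows "(\<Sum>x\<in>carrier_vec a. chi (u \<bullet> x)) = (if u = 0\<^sub>v a then 2 ^ a else 0)"
proof -
  have "(\<Sum>x\<in>carrier_vec a. chi (u \<bullet> x))
      = (if \<forall>x\<in>carrier_vec a. u \<bullet> x = 0 then int (card (carrier_vec a :: bit vec set)) else 0)"
    using u by (intro sum_chi_additive[of _ a]) (auto simp: scalar_prod_add_distrib[of _ a])
  also have "(\<forall>x\<in>carrier_vec a. u \<bullet> x = 0) \<longleftrightarrow> u = 0\<^sub>v a"
  proof
    assume "\<forall>x\<in>carrier_vec a. u \<bullet> x = 0"
    then have "u $ i = 0" if "i < a" for i
      using that u scalar_prod_right_unit[of i a u] by (metis unit_vec_carrier)
    then show "u = 0\<^sub>v a"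
      using u by (intro eq_vecI) auto
  qed simp
  finally show ?thesis
    by (simp add: card_carrier_vec_bit)
qed

lemma sum_chi_scalar_prod_nonzero:
  assumes "u \<in> carrier_vec a"
  shows "(\<Sum>x\<in>carrier_vec a - {0\<^sub>v a}. chi (u \<bullet> x)) = (if u = 0\<^sub>v a then 2 ^ a else 0) - 1"
  using assms sum_chi_scalar_prod[OF assms]
  by (simp add: sum_diff1 finite_carrier_vec_bit)

text \<open>With \<open>S\<close> the character sum over the whole of \<open>V\<close>, removing the zero vector subtracts \<open>1\<close>,
  and each of the two pieces of the point set contributes a product.\<close>

lemma sum_chi_pairing:
  assumes m: "(d, u, v) \<in> messages a"
  defines "S \<equiv> \<lambda>w :: bit vec. if w = 0\<^sub>v a then 2 ^ a else (0 :: int)"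
  shows "(\<Sum>p\<in>point_set a. chi (pairing (d, u, v) p))
    = S u * (S v - 1) + chi d * ((S u - 1) * S v)"
proof -
  let ?V = "carrier_vec a :: bit vec set" and ?V' = "carrier_vec a - {0\<^sub>v a} :: bit vec set"
  have uv: "u \<in> ?V" "v \<in> ?V"
    using m by (auto simp: messages_def)
  have product: "(\<Sum>p\<in>{e} \<times> A \<times> B. chi (pairing (d, u, v) p))
      = chi (d * e) * ((\<Sum>x\<in>A. chi (u \<bullet> x)) * (\<Sum>y\<in>B. chi (v \<bullet> y)))" for e A B
  proof -
    have "(\<Sum>p\<in>{e} \<times> A \<times> B. chi (pairing (d, u, v) p))
        = (\<Sum>x\<in>A. \<Sum>y\<in>B. chi (pairing (d, u, v) (e, x, y)))"
      by (simp add: sum.cartesian_product' del: pairing.simps)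
    then show ?thesis
      by (simp only: pairing.simps chi_add sum_product mult.assoc
          sum_distrib_left[where r = "chi (d * e)"])
  qed
  have "(\<Sum>p\<in>point_set a. chi (pairing (d, u, v) p))
      = (\<Sum>p\<in>{0} \<times> ?V \<times> ?V'. chi (pairing (d, u, v) p))
        + (\<Sum>p\<in>{1} \<times> ?V' \<times> ?V. chi (pairing (d, u, v) p))"
    unfolding point_set_def
    by (rule sum.union_disjoint) (auto simp: finite_carrier_vec_bit)
  then show ?thesis
    using uv by (simp add: product sum_chi_scalar_prod sum_chi_scalar_prod_nonzero S_def)
qed

text \<open>Applied to two points of the set this yields projectivity; applied to one point and zero it
  yields full length.\<close>

lemma point_set_separated:
  assumes "p \<in> messages a" "q \<in> messages a" "p \<noteq> q"
  shows "\<exists>m\<in>messages a. pairing m p \<noteq> pairing m q"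
proof -
  obtain e x y e' x' y' where pq: "p = (e, x, y)" "q = (e', x', y')"
    by (metis prod_cases3)
  have V: "x \<in> carrier_vec a" "y \<in> carrier_vec a" "x' \<in> carrier_vec a" "y' \<in> carrier_vec a"
    using assms pq by (auto simp: messages_def)
  have coordinate: "\<exists>i<a. z $ i \<noteq> z' $ i"
    if "z \<noteq> z'" "z \<in> carrier_vec a" "z' \<in> carrier_vec a" for z z' :: "bit vec"
    using that by (metis carrier_vecD eq_vecI)
  consider "e \<noteq> e'" | "x \<noteq> x'" | "y \<noteq> y'"
    using assms(3) pq by blast
  then show ?thesis
  proof cases
    case 1
    then show ?thesis
      using V pq by (intro bexI[of _ "(1, 0\<^sub>v a, 0\<^sub>v a)"]) (auto simp: messages_def)
  next
    case 2
    then obtain i where "i < a" "x $ i \<noteq> x' $ i"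
      using coordinate V by blast
    then show ?thesis
      using V pq by (intro bexI[of _ "(0, unit_vec a i, 0\<^sub>v a)"]) (auto simp: messages_def)
  next
    case 3
    then obtain i where "i < a" "y $ i \<noteq> y' $ i"
      using coordinate V by blast
    then show ?thesis
      using V pq by (intro bexI[of _ "(0, 0\<^sub>v a, unit_vec a i)"]) (auto simp: messages_def)
  qed
qed

text \<open>With \<open>s = 2 ^ a\<close> the length is \<open>2 s (s - 1)\<close> and the weights are \<open>n/2\<close> and \<open>n/2 \<plusminus> s/2\<close>.
  The number \<open>n/2\<close> is a multiple of \<open>2 ^ a\<close> and \<open>s/2\<close> is not, so divisibility by \<open>2 ^ a\<close> fails.\<close>

lemma exists_admissible_code:
  assumes a: "1 \<le> a"
  shows "\<exists>C. admissible_code a (2 ^ (2 * a + 1) - 2 ^ (a + 1)) (2 * a + 1) C"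
proof -
  define s :: int where "s = 2 ^ a"
  define n where "n = card (point_set a)"
  have s2: "2 \<le> s"
    using a self_le_power[of "2::int" a] by (simp add: s_def)
  have n: "int n = 2 * s * (s - 1)"
    using card_point_set by (simp add: n_def s_def)
  obtain p where p: "bij_betw p {..<n} (point_set a)"
    using ex_bij_betw_nat_finite[OF finite_point_set, of a]
    by (auto simp: n_def atLeast0LessThan)
  have p_mem: "p i \<in> point_set a" if "i < n" for i
    using p that by (auto simp: bij_betw_def)
  have p_msg: "p i \<in> messages a" if "i < n" for i
    using p_mem[OF that] point_set_subset by blast
  define word where "word m = vec n (\<lambda>i. pairing m (p i))" for m
  define C where "C = word ` messages a"
  have word_add: "word (msg_add m m') = word m + word m'"
    if "m \<in> messages a" "m' \<in> messages a" for m m'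
    using that p_msg by (intro eq_vecI) (auto simp: word_def pairing_msg_add)
  have zero_msg: "(0, 0\<^sub>v a, 0\<^sub>v a) \<in> messages a"
    by (simp add: messages_def)
  have word_zero: "word (0, 0\<^sub>v a, 0\<^sub>v a) = 0\<^sub>v n"
  proof (rule eq_vecI)
    fix i
    assume "i < dim_vec (0\<^sub>v n :: bit vec)"
    then show "word (0, 0\<^sub>v a, 0\<^sub>v a) $ i = 0\<^sub>v n $ i"
      using p_msg[of i] by (auto simp: word_def messages_def)
  qed (simp add: word_def)
  have char_sum_word: "char_sum (word m) = (\<Sum>q\<in>point_set a. chi (pairing m q))" for m
    using sum.reindex_bij_betw[OF p, of "\<lambda>q. chi (pairing m q)"]
    by (simp add: char_sum_def word_def)
  have char_sum_values: "char_sum (word (d, u, v)) =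
      (if u = 0\<^sub>v a \<and> v = 0\<^sub>v a then (if d = 0 then int n else 0)
       else if u = 0\<^sub>v a then - s
       else if v = 0\<^sub>v a then - chi d * s else 0)"
    if "(d, u, v) \<in> messages a" for d u v
    using sum_chi_pairing[OF that] n
    by (auto simp: char_sum_word s_def chi_def algebra_simps)
  have nonzero_msg: "char_sum (word m) \<in> {s, 0, - s}"
    if "m \<in> messages a" "m \<noteq> (0, 0\<^sub>v a, 0\<^sub>v a)" for m
    using that char_sum_values by (cases m) (auto simp: chi_def)
  have n_gt: "s < int n"
  proof -
    have "s * 1 < s * (2 * (s - 1))"
      using s2 by (intro mult_strict_left_mono) auto
    then show ?thesis
      using n by (simp add: mult.left_commute mult.assoc)
  qed
  \<comment> \<open>A message that encodes to zero has character sum \<open>n\<close>, which exceeds \<open>s\<close>, so it is zero.\<close>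
  have inj: "inj_on word (messages a)"
  proof (rule inj_onI)
    fix m m'
    assume mm: "m \<in> messages a" "m' \<in> messages a" "word m = word m'"
    have "word (msg_add m m') = word m' + word m'"
      using word_add mm by simp
    also have "\<dots> = 0\<^sub>v n"
      using add_self_bit_vec[of "0\<^sub>v n" n "word m'"] by (simp add: word_def)
    finally have "char_sum (word (msg_add m m')) = int n"
      by (simp add: char_sum_def)
    then have "msg_add m m' = (0, 0\<^sub>v a, 0\<^sub>v a)"
      using nonzero_msg[OF msg_add_closed[OF mm(1,2)]] n_gt s2 by force
    then show "m = m'"
      using msg_add_eq_zero mm by blast
  qed
  have "card C = 2 ^ (2 * a + 1)"
    unfolding C_def using card_image[OF inj] card_messages by simp
  moreover have "x + y \<in> C" if "x \<in> C" "y \<in> C" for x y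
    using that msg_add_closed by (auto simp: C_def simp flip: word_add)
  moreover have "C \<subseteq> carrier_vec n"
    by (auto simp: C_def word_def)
  moreover have "0\<^sub>v n \<in> C"
    unfolding C_def using word_zero zero_msg by (metis imageI)
  ultimately have code: "binary_code n (2 * a + 1) C"
    unfolding binary_code_iff by blast
  have pairing_zero: "pairing m (0, 0\<^sub>v a, 0\<^sub>v a) = 0" if "m \<in> messages a" for m
    using that by (cases m) (auto simp: messages_def)
  have full: "\<exists>c\<in>C. c $ i \<noteq> 0" if i: "i < n" for i
  proof -
    have "p i \<noteq> (0, 0\<^sub>v a, 0\<^sub>v a)"
      using p_mem[OF i] by (auto simp: point_set_def)
    then obtain m where "m \<in> messages a" "pairing m (p i) \<noteq> 0"
      using point_set_separated[OF p_msg[OF i] zero_msg] pairing_zero by metis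
    then show ?thesis
      using i by (auto simp: C_def word_def simp del: bit_not_zero_iff)
  qed
  have distinct: "\<exists>c\<in>C. c $ i \<noteq> c $ j" if ij: "i < n" "j < n" "i \<noteq> j" for i j
  proof -
    have "p i \<noteq> p j"
      using p ij unfolding bij_betw_def inj_on_def by blast
    then obtain m where "m \<in> messages a" "pairing m (p i) \<noteq> pairing m (p j)"
      using point_set_separated[OF p_msg[OF ij(1)] p_msg[OF ij(2)]] by blast
    then show ?thesis
      using ij by (auto simp: C_def word_def)
  qed
  have proj: "projective n C"
    unfolding projective_def full_length_def using full distinct by blast
  \<comment> \<open>\<open>w\<close> is half the length and \<open>t = s/2\<close>, as natural numbers; \<open>a \<ge> 1\<close> makes \<open>s\<close> even.\<close>
  define t :: nat where "t = 2 ^ (a - 1)"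
  define w where "w = 2 * t * (2 * t - 1)"
  have t: "0 < t" "(2::nat) ^ a = 2 * t"
    using a by (simp_all add: t_def flip: power_Suc)
  have st: "s = 2 * int t"
    unfolding s_def using arg_cong[OF t(2), of int] by simp
  have "t \<le> t * (2 * t - 1)"
    using t(1) by simp
  then have tw: "t < w"
    using t(1) by (simp add: w_def mult.assoc)
  have "int w = s * (s - 1)"
    using t(1) by (simp add: w_def st of_nat_diff)
  then have nw: "n = 2 * w"
    using n by linarith
  have weight_char: "char_sum (word m) = 2 * int w - 2 * int (weight (word m))" for m
    unfolding char_sum_eq_weight by (simp add: word_def nw)
  have weights: "nonzero_weights C = {w - t, w, w + t}"
  proof (intro equalityI subsetI)
    fix x
    assume "x \<in> nonzero_weights C"
    then obtain m where m: "m \<in> messages a" "weight (word m) = x" "x \<noteq> 0"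
      by (auto simp: nonzero_weights_def C_def)
    have "m \<noteq> (0, 0\<^sub>v a, 0\<^sub>v a)"
      using m weight_eq_0_iff[of "0\<^sub>v n" n] word_zero by auto
    then have "2 * int w - 2 * int x \<in> {s, 0, - s}"
      using nonzero_msg[OF m(1)] weight_char[of m] m(2) by simp
    then show "x \<in> {w - t, w, w + t}"
      using st tw by auto
  next
    fix x
    assume x: "x \<in> {w - t, w, w + t}"
    \<comment> \<open>Messages with a vanishing vector part realise \<open>s\<close>, \<open>0\<close> and \<open>-s\<close> as character sums.\<close>
    have unit: "unit_vec a 0 \<noteq> (0\<^sub>v a :: bit vec)"
      using a by (intro unit_vec_nonzero) simp
    have "\<exists>m\<in>messages a. char_sum (word m) = 2 * int w - 2 * int x"
    proof -
      consider "x = w - t" | "x = w" | "x = w + t"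
        using x by blast
      then show ?thesis
      proof cases
        case 1
        have "(1, unit_vec a 0, 0\<^sub>v a) \<in> messages a"
          by (simp add: messages_def)
        with 1 show ?thesis
          using char_sum_values unit st tw
          by (intro bexI[of _ "(1, unit_vec a 0, 0\<^sub>v a)"]) (simp_all add: chi_def of_nat_diff)
      next
        case 2
        have "(1, 0\<^sub>v a, 0\<^sub>v a) \<in> messages a"
          by (simp add: messages_def)
        with 2 show ?thesis
          using char_sum_values by (intro bexI[of _ "(1, 0\<^sub>v a, 0\<^sub>v a)"]) simp_all
      next
        case 3
        have "(0, 0\<^sub>v a, unit_vec a 0) \<in> messages a"
          by (simp add: messages_def)
        with 3 show ?thesis
          using char_sum_values unit st
          by (intro bexI[of _ "(0, 0\<^sub>v a, unit_vec a 0)"]) simp_all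
      qed
    qed
    then obtain m where "m \<in> messages a" "weight (word m) = x"
      using weight_char by force
    then show "x \<in> nonzero_weights C"
      using x tw t(1) by (auto simp: nonzero_weights_def C_def)
  qed
  have ndvd: "\<not> divisible_code (2 ^ a) C"
  proof
    assume div: "divisible_code (2 ^ a) C"
    have "2 ^ a dvd x" if "x \<in> nonzero_weights C" for x
      using that div by (auto simp: nonzero_weights_def divisible_code_def)
    then have "2 ^ a dvd w - t" "2 ^ a dvd w"
      unfolding weights by blast+
    then have "2 ^ a dvd t"
      using tw by (metis dvd_diffD1 less_imp_le)
    then show False
      using t by (auto dest: dvd_imp_le)
  qed
  have "n = 2 ^ (2 * a + 1) - 2 ^ (a + 1)"
  proof -
    have "(2::nat) ^ (2 * a + 1) = 2 * ((2 * t) * (2 * t))" "(2::nat) ^ (a + 1) = 2 * (2 * t)"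
      using t(2) by (simp_all add: mult_2 power_add)
    then show ?thesis
      by (simp only: nw w_def) (simp add: diff_mult_distrib2)
  qed
  moreover have "admissible_code a n (2 * a + 1) C"
    unfolding admissible_code_def three_weight_def
  proof (intro conjI code proj ndvd exI)
    show "nonzero_weights C = {w - t, w, w + t}"
      by (rule weights)
    show "card (nonzero_weights C) = 3"
    proof -
      have "w - t \<noteq> w" "w - t \<noteq> w + t" "w \<noteq> w + t"
        using t(1) tw by linarith+
      then show ?thesis
        unfolding weights by simp
    qed
    show "real (w - t) + real w + real (w + t) = 3 * real n / 2"
      using tw by (simp add: nw of_nat_diff)
  qed (use t(1) tw nw in auto)
  ultimately show ?thesis
    by auto
qed

theorem theorem5p13:
  fixes a :: nat
  assumes "a \<ge> 1"
  shows "finite (admissible_dims a) \<and> admissible_dims a \<noteq> {} \<and>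
         finite (admissible_lengths a) \<and> admissible_lengths a \<noteq> {} \<and>
         2 * a + 1 \<le> K_max a \<and> K_max a \<le> 8 * a + 1 \<and>
         (2::int) ^ (2 * a + 1) - 2 ^ (a + 1) \<le> int (N_max a) \<and>
         int (N_max a) \<le> 2 ^ K_max a - 3"
proof -
  obtain C where C: "admissible_code a (2 ^ (2 * a + 1) - 2 ^ (a + 1)) (2 * a + 1) C"
    using exists_admissible_code[OF assms] by blast
  have dims: "finite (admissible_dims a)"
    by (rule finite_subset[of _ "{..8 * a + 1}"])
      (auto simp: admissible_dims_def dest: admissible_code_bounds(1))
  have lengths: "finite (admissible_lengths a)"
  proof (rule finite_subset)
    show "admissible_lengths a \<subseteq> {..2 ^ (8 * a + 1)}"
    proof
      fix n
      assume "n \<in> admissible_lengths a"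
      then obtain k D where D: "admissible_code a n k D"
        by (auto simp: admissible_lengths_def)
      have "n \<le> 2 ^ k"
        using admissible_code_bounds(2)[OF D] by simp
      also have "(2::nat) ^ k \<le> 2 ^ (8 * a + 1)"
        by (intro power_increasing admissible_code_bounds(1)[OF D]) simp
      finally show "n \<in> {..2 ^ (8 * a + 1)}"
        by simp
    qed
  qed simp
  have dim_mem: "2 * a + 1 \<in> admissible_dims a"
    using C by (auto simp: admissible_dims_def)
  have length_mem: "2 ^ (2 * a + 1) - 2 ^ (a + 1) \<in> admissible_lengths a"
    using C by (auto simp: admissible_lengths_def)
  have "2 * a + 1 \<le> K_max a"
    unfolding K_max_def by (rule Max_ge[OF dims dim_mem])
  moreover have "K_max a \<le> 8 * a + 1"
    unfolding K_max_def using dims dim_mem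
    by (subst Max_le_iff) (auto simp: admissible_dims_def dest: admissible_code_bounds(1))
  moreover have "2 ^ (2 * a + 1) - 2 ^ (a + 1) \<le> N_max a"
    unfolding N_max_def by (rule Max_ge[OF lengths length_mem])
  then have "int (2 ^ (2 * a + 1)) - int (2 ^ (a + 1)) \<le> int (N_max a)"
    by linarith
  moreover have "N_max a + 3 \<le> 2 ^ K_max a"
  proof -
    have "N_max a \<in> admissible_lengths a"
      unfolding N_max_def using lengths length_mem by (intro Max_in) auto
    then obtain k D where D: "admissible_code a (N_max a) k D"
      by (auto simp: admissible_lengths_def)
    have "N_max a + 3 \<le> 2 ^ k"
      by (rule admissible_code_bounds(2)[OF D])
    also have "k \<le> K_max a"
      unfolding K_max_def using D by (intro Max_ge[OF dims]) (auto simp: admissible_dims_def)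
    then have "(2::nat) ^ k \<le> 2 ^ K_max a"
      by (intro power_increasing) simp_all
    finally show ?thesis .
  qed
  then have "int (N_max a) + 3 \<le> int (2 ^ K_max a)"
    by linarith
  ultimately show ?thesis
    using dims lengths dim_mem length_mem by auto
qed

end
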